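(* Let $q$ be a prime power, $s\ge1$, and let $N>1$ be an integer with $N-1\mid q^s-1$. Let $\Delta$ be a nonempty subset of $\{0,1,\dots,N-1\}$ with $0\in\Delta$, and let $d=d(\Delta)=\max\Delta$. The dimension over $\mathbb{F}_q$ of $\mathrm{PRS}(N,\Delta)_q$ is $$\dim \mathrm{PRS}(N,\Delta)_q=\begin{cases}\displaystyle\sum_{b\in\mathcal{B}:\,\mathfrak{I}_b\subset\Delta}n_b-(n_d-1)=\sum_{b\in\mathcal{B}:\,\mathfrak{I}_b\subset\Delta,\,b<d}n_b+1&\text{if }\mathfrak{I}_d\subset\Delta,\\[2ex]\displaystyle\sum_{b\in\mathcal{B}:\,\mathfrak{I}_b\subset\Delta}n_b&\text{otherwise.}\end{cases}$$
   Context: Points and codes. $Y_N=\{z\in\mathbb{F}_{q^s}: z^N=z\}$, $X_N=\{(1,z): z\in Y_N\}\cup\{(0,1)\}\subset \mathbb{F}_{q^s}^2$, $\mathrm{ev}_{X_N}(f)=(f(P))_{P\in X_N}\in\mathbb{F}_{q^s}^{N+1}$ for $f\in\mathbb{F}_{q^s}[x_0,x_1]$ (with $0^0=1$). $\mathrm{PRS}(N,\Delta)$ is the $\mathbb{F}_{q^s}$-linear code spanned by $\{\mathrm{ev}_{X_N}(x_0^{d(\Delta)-i}x_1^i): i\in\Delta\}$, and $\mathrm{PRS}(N,\Delta)_q=\mathrm{PRS}(N,\Delta)\cap\mathbb{F}_q^{N+1}$. Cyclotomic sets. Let $\mathbb{Z}_N=\{0\}\cup\mathbb{Z}/\langle N-1\rangle$,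 where the classes of $\mathbb{Z}/\langle N-1\rangle$ are represented by $\{1,\dots,N-1\}$ (so $0$ and $N-1$ are distinct and $q\cdot0=0$); $\mathbb{Z}_N$ is identified with $\{0,1,\dots,N-1\}$. $\mathfrak{I}_z=\{q^i\cdot z:i\ge0\}$ is the minimal cyclotomic set of $z$ with respect to $q$ and $n_z=|\mathfrak{I}_z|$. $\mathcal{B}$ is the set of largest elements of the minimal cyclotomic sets. *)

theory Defs
  imports
    "HOL-Computational_Algebra.Polynomial"
    "HOL-Number_Theory.Prime_Powers"
    "HOL-Library.Function_Algebras"
    "HOL-Library.Cardinality"
begin

text \<open>
  The small and the large finite field are types \<open>'k\<close> and \<open>'a\<close> of class \<open>{field,finite}\<close>.
  The inclusion of the small field in the large one is an embedding \<open>\<iota>\<close>; as a subset of the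
  large field, the small field is \<open>range \<iota>\<close>.
\<close>

definition field_embedding :: "('k::field \<Rightarrow> 'a::field) \<Rightarrow> bool" where
  "field_embedding \<iota> \<longleftrightarrow>
     \<iota> 1 = 1 \<and> (\<forall>x y. \<iota> (x + y) = \<iota> x + \<iota> y) \<and> (\<forall>x y. \<iota> (x * y) = \<iota> x * \<iota> y)"

definition Y_set :: "nat \<Rightarrow> 'a::field set" where
  "Y_set N = {z. z ^ N = z}"

definition X_set :: "nat \<Rightarrow> ('a::field \<times> 'a) set" where
  "X_set N = {(1, z) | z. z \<in> Y_set N} \<union> {(0, 1)}"

text \<open>
  A polynomial in \<open>x\<^sub>0, x\<^sub>1\<close> is an element of \<open>'a poly poly\<close>: the outer variable is \<open>x\<^sub>1\<close>, and
  the coefficients are polynomials in \<open>x\<^sub>0\<close>.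
\<close>

definition bi_monom :: "nat \<Rightarrow> nat \<Rightarrow> 'a::field poly poly" where
  "bi_monom i j = monom (monom 1 i) j"

definition bi_eval :: "'a::field poly poly \<Rightarrow> 'a \<times> 'a \<Rightarrow> 'a" where
  "bi_eval f = (\<lambda>(x0, x1). poly (poly f [:x1:]) x0)"

text \<open>
  A word with coordinates indexed by the points of \<open>X_set N\<close> is a function on all of
  \<open>'a \<times> 'a\<close> that vanishes off \<open>X_set N\<close>.
\<close>

definition words :: "nat \<Rightarrow> 'a::field set \<Rightarrow> ('a \<times> 'a \<Rightarrow> 'a) set" where
  "words N K = {v. (\<forall>P\<in>X_set N. v P \<in> K) \<and> (\<forall>P. P \<notin> X_set N \<longrightarrow> v P = 0)}"

definition ev :: "nat \<Rightarrow> 'a::field poly poly \<Rightarrow> ('a \<times> 'a \<Rightarrow> 'a)" where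
  "ev N f = (\<lambda>P. if P \<in> X_set N then bi_eval f P else 0)"

text \<open>The scalar action of the small field on words over the large field.\<close>

definition word_scale :: "('k \<Rightarrow> 'a::field) \<Rightarrow> 'k \<Rightarrow> ('p \<Rightarrow> 'a) \<Rightarrow> ('p \<Rightarrow> 'a)" where
  "word_scale \<iota> c v = (\<lambda>P. \<iota> c * v P)"

lemma vector_space_word_scale:
  assumes "field_embedding \<iota>"
  shows "vector_space (word_scale \<iota> :: 'k::field \<Rightarrow> ('p \<Rightarrow> 'a::field) \<Rightarrow> 'p \<Rightarrow> 'a)"
  using assms
  by unfold_locales (auto simp: field_embedding_def word_scale_def fun_eq_iff algebra_simps)

lemma field_embedding_id: "field_embedding (\<lambda>x. x)"
  by (simp add: field_embedding_def)

definition PRS :: "nat \<Rightarrow> nat set \<Rightarrow> ('a::field \<times> 'a \<Rightarrow> 'a) set" where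
  "PRS N \<Delta> = module.span (word_scale (\<lambda>x. x)) ((\<lambda>i. ev N (bi_monom (Max \<Delta> - i) i)) ` \<Delta>)"

definition PRS_sub :: "('k::field \<Rightarrow> 'a::field) \<Rightarrow> nat \<Rightarrow> nat set \<Rightarrow> ('a \<times> 'a \<Rightarrow> 'a) set" where
  "PRS_sub \<iota> N \<Delta> = PRS N \<Delta> \<inter> words N (range \<iota>)"

definition dim_sub :: "('k::field \<Rightarrow> 'a::field) \<Rightarrow> ('p \<Rightarrow> 'a) set \<Rightarrow> nat" where
  "dim_sub \<iota> = vector_space.dim (word_scale \<iota>)"

text \<open>
  \<open>\<int>\<^sub>N\<close> is \<open>{0..<N}\<close>; its nonzero elements are the representatives \<open>1, \<dots>, N - 1\<close> of the residue
  classes modulo \<open>N - 1\<close>, so a nonzero element whose multiple is divisible by \<open>N - 1\<close> goes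
  to \<open>N - 1\<close>, not to \<open>0\<close>.
\<close>

definition cyc_mult :: "nat \<Rightarrow> nat \<Rightarrow> nat \<Rightarrow> nat" where
  "cyc_mult N a z =
     (if z = 0 then 0
      else if (N - 1) dvd (a * z) then N - 1
      else (a * z) mod (N - 1))"

definition cyc_set :: "nat \<Rightarrow> nat \<Rightarrow> nat \<Rightarrow> nat set" where
  "cyc_set q N z = {cyc_mult N (q ^ i) z | i. True}"

definition cyc_reps :: "nat \<Rightarrow> nat \<Rightarrow> nat set" where
  "cyc_reps q N = {Max (cyc_set q N z) | z. z \<in> {0..<N}}"

end

(*
Coefficient vectors supported on Delta parametrise PRS(N, Delta), because monomials of degree < N are
independent on Y_N. The evaluation f has all its values in F_q iff f(z)^q = f(z) on Y_N and the
value a_d at (0, 1) satisfies a_d^q = a_d. The first condition says that the coefficient at q * i is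
a_i^q, so the support is a union of minimal cyclotomic sets and on each of them the vector is
determined by one coefficient in the field with q^(n_b) elements; the second one cuts the factor
belonging to b = d down to F_q. Counting these vectors gives the dimension as an exponent of q.
*)

theory Submission
  imports Defs "HOL-Number_Theory.Cong"
begin

section \<open>Linear algebra: finite spans and the number of vectors in a subspace\<close>

text \<open>The sum runs over indices rather than over the vectors \<open>f i\<close>, so
  \<open>f\<close> need not be injective. This form presents the code as the image of all
  coefficient vectors.\<close>

lemma (in module) span_image_finite:
  assumes "finite S"
  shows "span (f ` S) = range (\<lambda>u. \<Sum>i\<in>S. u i *s f i)"
proof
  show "range (\<lambda>u. \<Sum>i\<in>S. u i *s f i) \<subseteq> span (f ` S)"
    by (intro image_subsetI span_sum span_scale span_base imageI)
  show "span (f ` S) \<subseteq> range (\<lambda>u. \<Sum>i\<in>S. u i *s f i)"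
  proof (rule span_minimal)
    show "f ` S \<subseteq> range (\<lambda>u. \<Sum>i\<in>S. u i *s f i)"
    proof
      fix v assume "v \<in> f ` S"
      then obtain i where i: "i \<in> S" "v = f i" by auto
      have "(\<Sum>j\<in>S. (if j = i then 1 else 0) *s f j) = (\<Sum>j\<in>S. if j = i then f j else 0)"
        by (intro sum.cong) auto
      also have "\<dots> = v" using i assms by simp
      finally show "v \<in> range (\<lambda>u. \<Sum>i\<in>S. u i *s f i)"
        by (intro range_eqI[of _ _ "\<lambda>j. if j = i then 1 else 0"]) simp
    qed
    show "subspace (range (\<lambda>u. \<Sum>i\<in>S. u i *s f i))"
    proof (rule subspaceI)
      show "0 \<in> range (\<lambda>u. \<Sum>i\<in>S. u i *s f i)"
        by (intro range_eqI[of _ _ "\<lambda>_. 0"]) simp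
    next
      fix x y
      assume "x \<in> range (\<lambda>u. \<Sum>i\<in>S. u i *s f i)" "y \<in> range (\<lambda>u. \<Sum>i\<in>S. u i *s f i)"
      then obtain u w where "x = (\<Sum>i\<in>S. u i *s f i)" "y = (\<Sum>i\<in>S. w i *s f i)" by auto
      then show "x + y \<in> range (\<lambda>u. \<Sum>i\<in>S. u i *s f i)"
        by (intro range_eqI[of _ _ "\<lambda>i. u i + w i"]) (simp add: scale_left_distrib sum.distrib)
    next
      fix c x
      assume "x \<in> range (\<lambda>u. \<Sum>i\<in>S. u i *s f i)"
      then obtain u where "x = (\<Sum>i\<in>S. u i *s f i)" by auto
      then show "c *s x \<in> range (\<lambda>u. \<Sum>i\<in>S. u i *s f i)"
        by (intro range_eqI[of _ _ "\<lambda>i. c * u i"]) (simp add: scale_sum_right)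
    qed
  qed
qed

text \<open>Coordinates with respect to a basis are counted. This is the bridge from the cardinality
  of the code to its dimension.\<close>

lemma (in vector_space) card_subspace:
  assumes "subspace V" and "finite V"
  shows "card V = CARD('a) ^ dim V"
proof -
  obtain B where B: "B \<subseteq> V" "independent B" "V \<subseteq> span B" "card B = dim V"
    using basis_exists by blast
  have fin: "finite B" using B(1) assms(2) finite_subset by blast
  have V: "V = span B" using B(1,3) assms(1) span_minimal by blast
  let ?F = "\<lambda>u. \<Sum>v\<in>B. u v *s v"
  have "bij_betw ?F (B \<rightarrow>\<^sub>E UNIV) V"
    unfolding bij_betw_def
  proof
    show "inj_on ?F (B \<rightarrow>\<^sub>E UNIV)"
    proof (rule inj_onI)
      fix u w :: "'b \<Rightarrow> 'a"
      assume u: "u \<in> B \<rightarrow>\<^sub>E UNIV" "w \<in> B \<rightarrow>\<^sub>E UNIV" and eq: "?F u = ?F w"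
      have "(\<Sum>v\<in>B. (u v - w v) *s v) = 0"
        using eq by (simp add: scale_left_diff_distrib sum_subtractf)
      then have "u v - w v = 0" if "v \<in> B" for v
        using independentD[OF B(2) fin subset_refl _ that, of "\<lambda>v. u v - w v"] by blast
      then show "u = w" using u by (intro PiE_ext) auto
    qed
    show "?F ` (B \<rightarrow>\<^sub>E UNIV) = V"
    proof
      show "?F ` (B \<rightarrow>\<^sub>E UNIV) \<subseteq> V"
        unfolding V by (intro image_subsetI span_sum span_scale span_base)
      show "V \<subseteq> ?F ` (B \<rightarrow>\<^sub>E UNIV)"
      proof
        fix x assume "x \<in> V"
        then obtain u where "x = ?F u" unfolding V span_finite[OF fin] by auto
        then show "x \<in> ?F ` (B \<rightarrow>\<^sub>E UNIV)"
          by (intro image_eqI[of _ _ "restrict u B"]) simp_all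
      qed
    qed
  qed
  from bij_betw_same_card[OF this] have "card V = card (B \<rightarrow>\<^sub>E (UNIV :: 'a set))" by simp
  also have "\<dots> = CARD('a) ^ dim V" using fin B(4) by (simp add: card_PiE)
  finally show ?thesis .
qed

section \<open>Finite fields: roots of \<open>x ^ m = x\<close>\<close>

text \<open>Multiplication by a nonzero \<open>x\<close> permutes the nonzero elements; comparing
  the products over all of them gives \<open>x ^ (CARD('a) - 1) = 1\<close>.\<close>

lemma power_CARD_eq_same:
  fixes x :: "'a :: {field,finite}"
  shows "x ^ CARD('a) = x"
proof (cases "x = 0")
  case False
  have "(\<Prod>y\<in>UNIV-{0}. x * y) = (\<Prod>y\<in>UNIV-{0}. y)"
    by (rule prod.reindex_bij_witness[of _ "\<lambda>y. y / x" "\<lambda>y. x * y"]) (use False in auto)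
  then have "x ^ (CARD('a) - 1) = 1"
    by (simp add: prod.distrib)
  then show ?thesis
    using power_minus_mult[of "CARD('a)" x] finite_UNIV_card_ge_0[where ?'a = 'a] by simp
qed (use finite_UNIV_card_ge_0[where ?'a = 'a] in auto)

text \<open>Write \<open>k = m - 1\<close> and \<open>CARD('a) - 1 = k * l\<close>. The polynomial
  \<open>X ^ (k * l) - 1\<close> vanishes at all \<open>k * l\<close> nonzero elements and factors
  as \<open>(X ^ k - 1) * g\<close> with \<open>g\<close> of degree \<open>k * l - k\<close>. So at
  least \<open>k\<close> of these elements are roots of \<open>X ^ k - 1\<close>, which has no more
  than \<open>k\<close>; zero is the remaining solution. Cyclicity of the multiplicative group is
  avoided.\<close>

lemma card_power_eq_same:
  fixes m :: nat
  assumes "m > 1" and dvd: "(m - 1) dvd (CARD('a::{field,finite}) - 1)"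
  shows "card {x::'a. x ^ m = x} = m"
proof -
  define k where "k = m - 1"
  have m: "m = Suc k" and k: "k > 0" using assms by (auto simp: k_def)
  obtain l where l: "CARD('a) - 1 = k * l" using dvd by (auto simp: k_def)
  have two: "CARD('a) > 1"
    using card_mono[of UNIV "{0, 1::'a}"] by simp
  define p where "p = monom (1::'a) k - 1"
  define g where "g = (\<Sum>i<l. monom (1::'a) k ^ i)"
  have lpos: "l > 0" using two l by (cases l) auto
  have pg: "monom 1 (k * l) - 1 = p * g"
    using power_diff_1_eq[of "monom (1::'a) k" l] by (simp add: p_def g_def monom_power)
  have deg: "degree (monom (1::'a) n - 1) = n" if "n > 0" for n
  proof -
    have "degree (monom (1::'a) n - 1) = degree (monom (1::'a) n)"
      using that degree_add_eq_left[of "- (1 :: 'a poly)" "monom 1 n"] by (simp add: degree_monom_eq)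
    then show ?thesis by (simp add: degree_monom_eq)
  qed
  have nz: "p * g \<noteq> 0"
    using deg[of "k * l"] k lpos pg by force
  have pnz: "p \<noteq> 0" "g \<noteq> 0" using nz by auto
  have "degree p + degree g = k * l"
    using deg[of "k * l"] k lpos pg degree_mult_eq[OF pnz] by simp
  then have dg: "degree g = k * l - k" using deg[OF k] by (simp add: p_def)
  have root: "x \<noteq> 0 \<Longrightarrow> poly (p * g) x = 0" for x :: 'a
  proof -
    assume "x \<noteq> 0"
    have "x * x ^ (k * l) = x"
      using power_CARD_eq_same[of x] two l by (metis One_nat_def Suc_diff_1 less_trans power_Suc zero_less_one)
    then show ?thesis using \<open>x \<noteq> 0\<close> by (simp flip: pg add: poly_monom)
  qed
  have "k * l = card (UNIV - {0::'a})" using l by (simp add: card_Diff_singleton)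
  also have "\<dots> \<le> card ({x. poly p x = 0} \<union> {x. poly g x = 0})"
    using root by (intro card_mono) auto
  also have "\<dots> \<le> card {x. poly p x = 0} + card {x. poly g x = 0}" by (rule card_Un_le)
  also have "\<dots> \<le> card {x. poly p x = 0} + (k * l - k)"
    using card_poly_roots_bound[OF pnz(2)] dg by simp
  finally have "k \<le> card {x. poly p x = 0}" using lpos
    by (cases l) auto
  moreover have "card {x. poly p x = 0} \<le> k"
    using card_poly_roots_bound[OF pnz(1)] deg[OF k] by (simp add: p_def)
  ultimately have "card {x. poly p x = 0} = k" by simp
  moreover have "{x::'a. x ^ m = x} = insert 0 {x. poly p x = 0}"
    by (auto simp: m p_def poly_monom)
  moreover have "0 \<notin> {x. poly p x = 0}" using k by (simp add: p_def poly_monom power_0_left)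
  ultimately show ?thesis using m by simp
qed

lemma power_minus_one_dvd:
  fixes q :: nat
  assumes "n dvd s"
  shows "(q ^ n - 1) dvd (q ^ s - 1)"
proof (cases "q = 0")
  case False
  obtain l where s: "s = n * l" using assms by auto
  have "int (q ^ n) - 1 dvd int (q ^ n) ^ l - 1"
    using power_diff_1_eq[of "int (q ^ n)" l] by simp
  then have "int (q ^ n - 1) dvd int (q ^ s - 1)"
    using False by (simp add: of_nat_diff s power_mult)
  then show ?thesis by (simp only: int_dvd_int_iff)
qed (use assms in \<open>auto simp: power_0_left\<close>)

section \<open>Periodic orbits of a map\<close>

text \<open>The size of a periodic orbit is its least period \<open>p\<close>: the first
  \<open>p\<close> iterates are distinct, and every other exponent can be reduced modulo
  \<open>p\<close>.\<close>

lemma funpow_eq_iff_cong_card_orbit: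
  fixes f :: "'a \<Rightarrow> 'a"
  assumes "(f ^^ s) x = x" and "s > 0"
  shows "(f ^^ i) x = (f ^^ j) x \<longleftrightarrow> [i = j] (mod card (range (\<lambda>i. (f ^^ i) x)))"
proof -
  define p where "p = (LEAST p. p > 0 \<and> (f ^^ p) x = x)"
  have p: "p > 0" "(f ^^ p) x = x"
    using LeastI[of "\<lambda>p. p > 0 \<and> (f ^^ p) x = x" s] assms by (auto simp: p_def)
  have least: "\<not> (0 < i \<and> i < p \<and> (f ^^ i) x = x)" for i
    using not_less_Least[of i "\<lambda>p. p > 0 \<and> (f ^^ p) x = x"] by (auto simp: p_def)
  have neq: "(f ^^ i) x \<noteq> (f ^^ j) x" if "i < j" "j < p" for i j
  proof
    assume "(f ^^ i) x = (f ^^ j) x"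
    \<comment> \<open>Applying \<open>p - j\<close> further iterations turns a coincidence with
      \<open>i < j < p\<close> into the period \<open>p - j + i\<close>, which is positive and
      smaller than \<open>p\<close>.\<close>
    then have "(f ^^ (p - j)) ((f ^^ i) x) = (f ^^ (p - j)) ((f ^^ j) x)" by simp
    then have "(f ^^ (p - j + i)) x = (f ^^ (p - j + j)) x" by (simp add: funpow_add)
    then show False using least[of "p - j + i"] that p(2) by simp
  qed
  have inj: "inj_on (\<lambda>i. (f ^^ i) x) {..<p}"
    by (rule inj_onI) (metis lessThan_iff linorder_neqE_nat neq)
  have modp: "(f ^^ (i mod p)) x = (f ^^ i) x" for i
    using p(2) by (rule funpow_mod_eq)
  have "range (\<lambda>i. (f ^^ i) x) = (\<lambda>i. (f ^^ i) x) ` {..<p}"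
    using modp p(1) by (force intro: rev_image_eqI[of "_ mod p"])
  then have "card (range (\<lambda>i. (f ^^ i) x)) = p" using inj by (simp add: card_image)
  moreover have "(f ^^ i) x = (f ^^ j) x \<longleftrightarrow> i mod p = j mod p"
    using inj_on_eq_iff[OF inj, of "i mod p" "j mod p"] p(1) by (simp add: modp)
  ultimately show ?thesis by (simp add: cong_def)
qed

section \<open>Arithmetic in \<open>{0..<N}\<close> and minimal cyclotomic sets\<close>

locale cyclotomic =
  fixes q s N :: nat
  assumes q_gt_1: "q > 1" and s_pos: "s > 0" and N_gt_1: "N > 1"
    and dvd_qs: "(N - 1) dvd (q ^ s - 1)"
begin

abbreviation \<sigma> :: "nat \<Rightarrow> nat" where "\<sigma> \<equiv> cyc_mult N q"

abbreviation orb :: "nat \<Rightarrow> nat set" where "orb \<equiv> cyc_set q N"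

lemma cyc_mult_less [simp]: "cyc_mult N a z < N"
  using N_gt_1 by (auto simp: cyc_mult_def intro: less_trans[OF mod_less_divisor])

lemma cyc_mult_0 [simp]: "cyc_mult N a 0 = 0"
  by (simp add: cyc_mult_def)

lemma cyc_mult_pos: "z > 0 \<Longrightarrow> cyc_mult N a z > 0"
  using N_gt_1 by (auto simp: cyc_mult_def dvd_eq_mod_eq_0)

lemma cyc_mult_cong: "z > 0 \<Longrightarrow> [cyc_mult N a z = a * z] (mod (N - 1))"
  by (auto simp: cyc_mult_def cong_def)

text \<open>The numbers \<open>1, ..., N - 1\<close> represent each class modulo
  \<open>N - 1\<close> exactly once, with \<open>N - 1\<close> for the zero class, so the congruence
  determines the representative.\<close>

lemma cyc_mult_eqI:
  assumes "z > 0" "w > 0" "w < N" "[w = a * z] (mod (N - 1))"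
  shows "cyc_mult N a z = w"
proof (cases "w = N - 1")
  case True
  then have "N - 1 dvd a * z" using assms(4) by (simp add: cong_def dvd_eq_mod_eq_0)
  then show ?thesis using True assms(1) by (simp add: cyc_mult_def)
next
  case False
  then have w: "w mod (N - 1) = w" using assms by simp
  then have "(a * z) mod (N - 1) = w" using assms(4) by (simp add: cong_def)
  then show ?thesis using assms by (auto simp: cyc_mult_def)
qed

lemma cyc_mult_1: "z < N \<Longrightarrow> cyc_mult N 1 z = z"
  by (cases "z = 0") (auto intro!: cyc_mult_eqI)

lemma cyc_mult_mult: "cyc_mult N a (cyc_mult N b z) = cyc_mult N (a * b) z"
proof (cases "z = 0")
  case False
  then have z: "z > 0" by simp
  have "[a * cyc_mult N b z = a * (b * z)] (mod (N - 1))"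
    using cyc_mult_cong[OF z] by (rule cong_scalar_left)
  moreover have "[cyc_mult N (a * b) z = a * (b * z)] (mod (N - 1))"
    using cyc_mult_cong[OF z, of "a * b"] by (simp add: mult.assoc)
  ultimately show ?thesis
    using z by (intro cyc_mult_eqI cyc_mult_pos) (auto intro: cong_trans cong_sym)
qed simp

text \<open>Makes a cyclotomic set an orbit of the single map \<open>\<sigma>\<close>, so that the
  facts on periodic orbits apply.\<close>

lemma funpow_eq_cyc_mult: "z < N \<Longrightarrow> (\<sigma> ^^ i) z = cyc_mult N (q ^ i) z"
proof (induction i)
  case 0
  then show ?case using cyc_mult_1 by simp
qed (simp add: cyc_mult_mult)

lemma funpow_less: "z < N \<Longrightarrow> (\<sigma> ^^ i) z < N"
  by (simp add: funpow_eq_cyc_mult)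

text \<open>Since \<open>N - 1\<close> divides \<open>q ^ s - 1\<close>, multiplication by
  \<open>q ^ s\<close> fixes every class.\<close>

lemma funpow_s: "z < N \<Longrightarrow> (\<sigma> ^^ s) z = z"
proof (cases "z = 0")
  case False
  assume z: "z < N"
  have "[q ^ s = 1] (mod (N - 1))"
    using dvd_qs q_gt_1 by (subst cong_altdef_nat) auto
  then have "[q ^ s * z = 1 * z] (mod (N - 1))" by (rule cong_scalar_right)
  then show ?thesis
    unfolding funpow_eq_cyc_mult[OF z] using False z
    by (intro cyc_mult_eqI) (auto intro: cong_sym)
qed (simp add: funpow_eq_cyc_mult)

lemma orb_eq_range: "z < N \<Longrightarrow> orb z = range (\<lambda>i. (\<sigma> ^^ i) z)"
  by (auto simp: cyc_set_def funpow_eq_cyc_mult)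

lemma self_in_orb: "z < N \<Longrightarrow> z \<in> orb z"
  by (auto simp: orb_eq_range intro: range_eqI[of _ _ 0])

lemma orb_less: "y \<in> orb z \<Longrightarrow> y < N"
  by (auto simp: cyc_set_def)

lemma finite_orb: "finite (orb z)"
  by (rule finite_subset[of _ "{..<N}"]) (auto dest: orb_less)

lemma orb_funpow:
  assumes z: "z < N"
  shows "orb ((\<sigma> ^^ i) z) = orb z"
proof -
  have 1: "orb ((\<sigma> ^^ j) y) \<subseteq> orb y" if "y < N" for j y
  proof
    fix x assume "x \<in> orb ((\<sigma> ^^ j) y)"
    then obtain i where "x = (\<sigma> ^^ i) ((\<sigma> ^^ j) y)"
      using orb_eq_range[OF funpow_less] \<open>y < N\<close> by auto
    then have "x = (\<sigma> ^^ (i + j)) y" by (simp only: funpow_add comp_apply)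
    then show "x \<in> orb y" using orb_eq_range \<open>y < N\<close> by blast
  qed
  \<comment> \<open>Iterating \<open>s * i - i\<close> times more completes \<open>s * i\<close>
    steps, a multiple of the period \<open>s\<close>. This leads back to \<open>z\<close> and gives
    the reverse inclusion.\<close>
  have "(\<sigma> ^^ (s * i - i)) ((\<sigma> ^^ i) z) = (\<sigma> ^^ (s * i - i + i)) z"
    by (simp only: funpow_add comp_apply)
  also have "s * i - i + i = s * i" using s_pos by (cases s) auto
  also have "(\<sigma> ^^ (s * i)) z = z"
    using funpow_mod_eq[OF funpow_s[OF z], of "s * i"] by simp
  finally have "orb z \<subseteq> orb ((\<sigma> ^^ i) z)"
    using 1[of "(\<sigma> ^^ i) z" "s * i - i"] funpow_less[OF z] by simp
  with 1[OF z] show ?thesis by blast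
qed

lemma orb_eqI: "y \<in> orb z \<Longrightarrow> z < N \<Longrightarrow> orb y = orb z"
  using orb_funpow by (auto simp: orb_eq_range)

lemma funpow_eq_iff:
  "z < N \<Longrightarrow> (\<sigma> ^^ i) z = (\<sigma> ^^ j) z \<longleftrightarrow> [i = j] (mod card (orb z))"
  using funpow_eq_iff_cong_card_orbit[OF funpow_s s_pos] by (simp add: orb_eq_range)

lemma funpow_card_orb: "z < N \<Longrightarrow> (\<sigma> ^^ card (orb z)) z = z"
  using funpow_eq_iff[of z "card (orb z)" 0] by (simp add: cong_def)

lemma card_orb_dvd: "z < N \<Longrightarrow> card (orb z) dvd s"
  using funpow_eq_iff[of z s 0] funpow_s[of z] by (simp add: cong_def dvd_eq_mod_eq_0)

lemma card_orb_pos: "z < N \<Longrightarrow> card (orb z) > 0"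
  using self_in_orb[of z] finite_orb[of z] by (auto simp: card_gt_0_iff)

lemma Max_orb_in: "z < N \<Longrightarrow> Max (orb z) \<in> orb z"
  using self_in_orb[of z] finite_orb[of z] by (intro Max_in) auto

lemma cyc_reps_iff: "b \<in> cyc_reps q N \<longleftrightarrow> b < N \<and> Max (orb b) = b"
proof
  assume "b \<in> cyc_reps q N"
  then obtain z where z: "z < N" "b = Max (orb z)" by (auto simp: cyc_reps_def)
  then have "b \<in> orb z" using Max_orb_in by simp
  then show "b < N \<and> Max (orb b) = b" using z orb_eqI orb_less by metis
next
  assume "b < N \<and> Max (orb b) = b"
  then show "b \<in> cyc_reps q N" by (force simp: cyc_reps_def)
qed

lemma Max_orb_rep: "z < N \<Longrightarrow> Max (orb z) \<in> cyc_reps q N"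
  by (auto simp: cyc_reps_def)

lemma orb_Max: "z < N \<Longrightarrow> orb (Max (orb z)) = orb z"
  using Max_orb_in orb_eqI by blast

text \<open>For \<open>y\<close> nonzero, \<open>y ^ (N - 1) = 1\<close>, so exponents matter only
  modulo \<open>N - 1\<close>. For \<open>y = 0\<close> the two exponents must vanish together; this
  is where keeping \<open>0\<close> and \<open>N - 1\<close> apart matters, and \<open>a > 0\<close>
  as well.\<close>

lemma power_cyc_mult:
  assumes "y \<in> Y_set N" and "a > 0"
  shows "y ^ cyc_mult N a z = y ^ (a * z)"
proof (cases "z = 0 \<or> y = 0")
  case True
  then show ?thesis using assms(2) cyc_mult_pos[of z a] by (cases "z = 0") (auto simp: power_0_left)
next
  case False
  have "y * y ^ (N - 1) = y"
    using assms(1) N_gt_1 by (simp add: Y_set_def flip: power_Suc)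
  then have y1: "y ^ (N - 1) = 1" using False by simp
  have "y ^ i = y ^ (i mod (N - 1))" for i
  proof -
    have "y ^ i = y ^ ((N - 1) * (i div (N - 1)) + i mod (N - 1))" by simp
    then show ?thesis unfolding power_add power_mult y1 by simp
  qed
  then show ?thesis using cyc_mult_cong[of z a] False unfolding cong_def by (metis gr0I)
qed


lemma orb_rep_exhaust:
  assumes "i < N"
  obtains b j where "b \<in> cyc_reps q N" "orb b = orb i" "(\<sigma> ^^ j) b = i"
proof -
  let ?b = "Max (orb i)"
  have b: "?b < N" using Max_orb_in[OF assms] orb_less by blast
  have "i \<in> orb ?b" using self_in_orb[OF assms] orb_Max[OF assms] by simp
  then obtain j where "i = (\<sigma> ^^ j) ?b" unfolding orb_eq_range[OF b] by (rule rangeE)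
  then have "(\<sigma> ^^ j) ?b = i" by (rule sym)
  with that show thesis using Max_orb_rep[OF assms] orb_Max[OF assms] by blast
qed

section \<open>Frobenius-compatible coefficient vectors and their number\<close>

text \<open>
  The coefficient vectors of the words with values in the small field (see \<open>frobenius_fixed_iff\<close>);
  the condition at \<open>d\<close> comes from the point \<open>(0, 1)\<close>.
\<close>

definition coeffs_sub :: "nat set \<Rightarrow> nat \<Rightarrow> (nat \<Rightarrow> 'a::field) set" where
  "coeffs_sub \<Delta> d = {a. (\<forall>i. i \<notin> \<Delta> \<longrightarrow> a i = 0) \<and> (\<forall>i<N. a (\<sigma> i) = a i ^ q) \<and> a d ^ q = a d}"

lemma coeffs_sub_funpow:
  assumes "a \<in> coeffs_sub \<Delta> d" "i < N"
  shows "a ((\<sigma> ^^ j) i) = a i ^ (q ^ j)"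
proof (induction j)
  case (Suc j)
  have "a ((\<sigma> ^^ Suc j) i) = a ((\<sigma> ^^ j) i) ^ q"
    using assms funpow_less[OF assms(2), of j] by (simp add: coeffs_sub_def)
  then show ?case using Suc by (simp add: mult.commute flip: power_mult)
qed simp

text \<open>Somewhere on the orbit the coefficient lies outside \<open>\<Delta>\<close> and is zero.
  It is a power of \<open>a i\<close>, and a field has no nonzero nilpotents.\<close>

lemma coeffs_sub_eq_0:
  assumes a: "a \<in> coeffs_sub \<Delta> d" and i: "i < N" and "\<not> orb i \<subseteq> \<Delta>"
  shows "a i = 0"
proof -
  obtain j where "(\<sigma> ^^ j) i \<notin> \<Delta>" using assms(3) orb_eq_range[OF i] by auto
  then have "a ((\<sigma> ^^ j) i) = 0" using a by (simp add: coeffs_sub_def)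
  then show ?thesis using coeffs_sub_funpow[OF a i, of j] by simp
qed

text \<open>With \<open>n\<close> the size of a cyclotomic set, these elements are the possible
  values of its free coefficient; \<open>n = 1\<close> gives the copy of the small field.\<close>

lemma card_power_q_power_eq_same:
  assumes "CARD('a::{field,finite}) = q ^ s" "n dvd s" "n > 0"
  shows "card {x::'a. x ^ (q ^ n) = x} = q ^ n"
proof (rule card_power_eq_same)
  show "1 < q ^ n" using q_gt_1 assms(3) by (rule one_less_power)
  show "q ^ n - 1 dvd CARD('a) - 1" using assms power_minus_one_dvd by simp
qed

text \<open>Values prescribed at the representatives are spread along each orbit by powers of
  Frobenius. The condition on \<open>x b\<close> ensures that one full turn around the orbit returns
  the same value.\<close>

lemma coeffs_sub_extend:
  fixes x :: "nat \<Rightarrow> 'a::field"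
  assumes \<Delta>: "\<Delta> \<subseteq> {..<N}" and d: "d < N" "orb d \<subseteq> \<Delta> \<Longrightarrow> d \<in> cyc_reps q N"
    and x: "\<And>b. b \<in> cyc_reps q N \<Longrightarrow> orb b \<subseteq> \<Delta> \<Longrightarrow> x b ^ (q ^ card (orb b)) = x b"
    and xd: "orb d \<subseteq> \<Delta> \<Longrightarrow> x d ^ q = x d"
  shows "\<exists>a\<in>coeffs_sub \<Delta> d. \<forall>b\<in>cyc_reps q N. orb b \<subseteq> \<Delta> \<longrightarrow> a b = x b"
proof -
  \<comment> \<open>The orbit's representative is its maximum. Any number of steps from there to
    \<open>i\<close> may be chosen; \<open>key\<close> shows that the value does not depend on
    it.\<close>
  define a where "a = (\<lambda>i. if i < N \<and> orb i \<subseteq> \<Delta>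
      then x (Max (orb i)) ^ (q ^ (SOME j. (\<sigma> ^^ j) (Max (orb i)) = i)) else 0)"
  have key: "a ((\<sigma> ^^ j) b) = x b ^ (q ^ j)" if b: "b \<in> cyc_reps q N" "orb b \<subseteq> \<Delta>" for b j
  proof -
    have bN: "b < N" "Max (orb b) = b" using b(1) by (auto simp: cyc_reps_iff)
    define k where "k = (SOME k. (\<sigma> ^^ k) b = (\<sigma> ^^ j) b)"
    have "(\<sigma> ^^ k) b = (\<sigma> ^^ j) b" unfolding k_def by (rule someI[of _ j]) simp
    then have "k mod card (orb b) = j mod card (orb b)"
      using funpow_eq_iff[OF bN(1)] by (simp add: cong_def)
    \<comment> \<open>Under \<open>y ^ q\<close> the point \<open>x b\<close> returns after
      \<open>card (orb b)\<close> steps, so only the residue of \<open>m\<close> counts.\<close>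
    moreover have "x b ^ (q ^ m) = x b ^ (q ^ (m mod card (orb b)))" for m
    proof -
      have F: "((\<lambda>y. y ^ r) ^^ m) y = y ^ (r ^ m)" for r m and y :: 'a
        by (induction m) (simp_all add: mult.commute flip: power_mult)
      show ?thesis
        using funpow_mod_eq[of "card (orb b)" "\<lambda>y. y ^ q" "x b" m] x[OF b] by (simp add: F)
    qed
    ultimately have "x b ^ (q ^ k) = x b ^ (q ^ j)" by metis
    then show ?thesis
      using funpow_less[OF bN(1)] b(2) by (simp add: a_def orb_funpow bN k_def)
  qed
  have "a \<in> coeffs_sub \<Delta> d"
    unfolding coeffs_sub_def
  proof (intro CollectI conjI allI impI)
    show "a i = 0" if "i \<notin> \<Delta>" for i
      using that self_in_orb[of i] by (auto simp: a_def)
    show "a (\<sigma> i) = a i ^ q" if i: "i < N" for i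
    proof (cases "orb i \<subseteq> \<Delta>")
      case True
      obtain b j where b: "b \<in> cyc_reps q N" "orb b = orb i" "(\<sigma> ^^ j) b = i"
        using orb_rep_exhaust[OF i] .
      have "a (\<sigma> i) = x b ^ (q ^ Suc j)" using key[of b "Suc j"] b True by simp
      also have "\<dots> = a i ^ q" using key[of b j] b True by (simp add: mult.commute flip: power_mult)
      finally show ?thesis .
    next
      case False
      moreover have "orb (\<sigma> i) = orb i" using orb_funpow[OF i, of 1] by simp
      ultimately show ?thesis using q_gt_1 by (simp add: a_def)
    qed
    \<comment> \<open>If the orbit of \<open>d\<close> leaves \<open>\<Delta>\<close>, then
      \<open>a d = 0\<close> and the condition is trivial; otherwise \<open>d\<close> is a
      representative and \<open>a d = x d\<close>.\<close>
    show "a d ^ q = a d"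
      using key[of d 0] d xd q_gt_1 by (cases "orb d \<subseteq> \<Delta>") (auto simp: a_def)
  qed
  moreover have "a b = x b" if "b \<in> cyc_reps q N" "orb b \<subseteq> \<Delta>" for b
    using key[OF that, of 0] by simp
  ultimately show ?thesis by blast
qed

text \<open>Restriction to the representatives whose orbit lies in \<open>\<Delta>\<close> is a
  bijection onto a product of fixed fields of Frobenius powers; the sizes of the factors
  multiply.\<close>

lemma card_coeffs_sub:
  assumes card: "CARD('a::{field,finite}) = q ^ s"
    and \<Delta>: "\<Delta> \<subseteq> {..<N}" and d: "d < N" "orb d \<subseteq> \<Delta> \<Longrightarrow> d \<in> cyc_reps q N"
  shows "card (coeffs_sub \<Delta> d :: (nat \<Rightarrow> 'a) set)
    = q ^ (\<Sum>b\<in>{b \<in> cyc_reps q N. orb b \<subseteq> \<Delta>}. if b = d then 1 else card (orb b))"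
proof -
  define R where "R = {b \<in> cyc_reps q N. orb b \<subseteq> \<Delta>}"
  \<comment> \<open>At \<open>d\<close> the condition from \<open>(0, 1)\<close> implies the one
    from the orbit, so the factor is the small field and the exponent drops to
    \<open>1\<close>.\<close>
  define e where "e b = (if b = d then 1 else card (orb b))" for b
  define V where "V b = {x::'a. x ^ (q ^ e b) = x}" for b
  have R: "b < N" "Max (orb b) = b" "orb b \<subseteq> \<Delta>" if "b \<in> R" for b
    using that by (auto simp: R_def cyc_reps_iff)
  have finR: "finite R" by (rule finite_subset[of _ "{..<N}"]) (auto dest: R)
  have d0: "x d ^ q = x d" if "x \<in> coeffs_sub \<Delta> d" for x :: "nat \<Rightarrow> 'a"
    using that by (simp add: coeffs_sub_def)
  have "bij_betw (\<lambda>a. restrict a R) (coeffs_sub \<Delta> d) (PiE R V)"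
    unfolding bij_betw_def
  proof
    show "inj_on (\<lambda>a. restrict a R) (coeffs_sub \<Delta> d :: (nat \<Rightarrow> 'a) set)"
    proof (intro inj_onI ext)
      fix a a' :: "nat \<Rightarrow> 'a" and i
      assume a: "a \<in> coeffs_sub \<Delta> d" "a' \<in> coeffs_sub \<Delta> d" and eq: "restrict a R = restrict a' R"
      consider "i \<notin> \<Delta>" | "i < N" "\<not> orb i \<subseteq> \<Delta>" | "i < N" "orb i \<subseteq> \<Delta>" using \<Delta> by blast
      then show "a i = a' i"
      proof cases
        case 3
        obtain b j where b: "b \<in> cyc_reps q N" "orb b = orb i" "(\<sigma> ^^ j) b = i"
          using orb_rep_exhaust[OF 3(1)] .
        have "b \<in> R" using b 3 by (simp add: R_def)
        then have "a b = a' b" "b < N" using eq R(1) by (metis restrict_apply', blast)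
        then show ?thesis using coeffs_sub_funpow[of _ \<Delta> d b j] a b(3) by metis
      qed (use a coeffs_sub_eq_0[OF a(1)] coeffs_sub_eq_0[OF a(2)] in \<open>simp_all add: coeffs_sub_def\<close>)
    qed
    show "(\<lambda>a. restrict a R) ` coeffs_sub \<Delta> d = PiE R V"
    proof
      show "(\<lambda>a. restrict a R) ` coeffs_sub \<Delta> d \<subseteq> PiE R V"
      proof (intro image_subsetI restrict_PiE_iff[THEN iffD2] ballI)
        fix a :: "nat \<Rightarrow> 'a" and b assume a: "a \<in> coeffs_sub \<Delta> d" and b: "b \<in> R"
        show "a b \<in> V b"
          using coeffs_sub_funpow[OF a R(1)[OF b], of "card (orb b)"] d0[OF a]
            funpow_card_orb[OF R(1)[OF b]] by (auto simp: V_def e_def)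
      qed
      show "PiE R V \<subseteq> (\<lambda>a. restrict a R) ` coeffs_sub \<Delta> d"
      proof
        fix x assume x: "x \<in> PiE R V"
        have "\<exists>a\<in>coeffs_sub \<Delta> d. \<forall>b\<in>cyc_reps q N. orb b \<subseteq> \<Delta> \<longrightarrow> a b = x b"
        proof (rule coeffs_sub_extend[OF \<Delta> d])
          show xd: "x d ^ q = x d" if "orb d \<subseteq> \<Delta>"
            using PiE_mem[OF x, of d] d(2)[OF that] that by (simp add: R_def V_def e_def)
          show "x b ^ (q ^ card (orb b)) = x b" if b: "b \<in> cyc_reps q N" "orb b \<subseteq> \<Delta>" for b
          proof (cases "b = d")
            case True
            have "x d ^ (q ^ n) = x d" for n
              using xd b True by (induction n) (simp_all add: power_mult)
            then show ?thesis using True by simp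
          next
            case False
            then show ?thesis using PiE_mem[OF x, of b] b by (simp add: R_def V_def e_def)
          qed
        qed
        then obtain a where a: "a \<in> coeffs_sub \<Delta> d" "\<And>b. b \<in> R \<Longrightarrow> a b = x b"
          by (auto simp: R_def)
        have "x = restrict a R"
          using x a(2) by (intro PiE_ext[of _ R V]) (auto simp: PiE_def Pi_def)
        then show "x \<in> (\<lambda>a. restrict a R) ` coeffs_sub \<Delta> d" using a(1) by blast
      qed
    qed
  qed
  then have "card (coeffs_sub \<Delta> d :: (nat \<Rightarrow> 'a) set) = (\<Prod>b\<in>R. card (V b))"
    using finR by (simp add: bij_betw_same_card card_PiE)
  also have "\<dots> = (\<Prod>b\<in>R. q ^ e b)"
    using card_power_q_power_eq_same[OF card] card_orb_dvd card_orb_pos R(1)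
    by (intro prod.cong) (auto simp: V_def e_def)
  also have "\<dots> = q ^ (\<Sum>b\<in>R. e b)" by (simp add: power_sum)
  finally show ?thesis by (simp add: R_def e_def)
qed

section \<open>Evaluation on \<open>Y_set N\<close> and the Frobenius map\<close>

lemma card_Y_set:
  assumes "CARD('a::{field,finite}) = q ^ s"
  shows "card (Y_set N :: 'a set) = N"
  unfolding Y_set_def using N_gt_1 dvd_qs assms by (intro card_power_eq_same) simp_all

text \<open>Two polynomials of degree less than \<open>N\<close> that agree at the \<open>N\<close>
  points of \<open>Y_set N\<close> are equal.\<close>

lemma coeffs_eqI_Y_set:
  fixes c c' :: "nat \<Rightarrow> 'a::{field,finite}"
  assumes "CARD('a) = q ^ s"
    and eq: "\<And>z. z \<in> Y_set N \<Longrightarrow> (\<Sum>i<N. c i * z ^ i) = (\<Sum>i<N. c' i * z ^ i)"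
    and i: "i < N"
  shows "c i = c' i"
proof -
  define p where "p c = (\<Sum>i<N. monom (c i) i)" for c :: "nat \<Rightarrow> 'a"
  have deg: "degree (p c) < N" for c
  proof -
    have "degree (p c) \<le> N - 1"
      unfolding p_def by (intro degree_sum_le) (auto intro: order_trans[OF degree_monom_le])
    then show ?thesis using N_gt_1 by simp
  qed
  have "p c = p c'"
  proof (rule poly_eqI_degree)
    show "poly (p c) z = poly (p c') z" if "z \<in> Y_set N" for z
      using eq[OF that] by (simp add: p_def poly_sum poly_monom)
  qed (use deg card_Y_set[OF assms(1)] in auto)
  moreover have "coeff (p c) i = c i" for c
    using i by (simp add: p_def coeff_sum)
  ultimately show ?thesis by metis
qed

text \<open>The prime below \<open>q\<close> is the characteristic, because the characteristic
  divides the cardinality \<open>q ^ s\<close>; so the freshman's dream applies.\<close>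

lemma power_q_sum:
  fixes f :: "'i \<Rightarrow> 'a::{field,finite}"
  assumes "CARD('a) = q ^ s" "primepow q"
  shows "sum f A ^ q = (\<Sum>i\<in>A. f i ^ q)"
proof -
  obtain p k where p: "prime p" "q = p ^ k" using assms(2) by (auto simp: primepow_def)
  have pr: "prime CHAR('a)"
    by (intro prime_CHAR_semidom finite_imp_CHAR_pos) simp
  \<comment> \<open>Translation by \<open>1\<close> permutes the field, so the two sums agree and
    their difference, \<open>CARD('a)\<close> copies of \<open>1\<close>, is zero.\<close>
  have "(\<Sum>x\<in>UNIV. x + 1) = (\<Sum>x\<in>(UNIV::'a set). x)"
    by (rule sum.reindex_bij_witness[of _ "\<lambda>x. x - 1" "\<lambda>x. x + 1"]) auto
  then have "of_nat CARD('a) = (0::'a)" by (simp add: sum.distrib)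
  then have "CHAR('a) dvd q ^ s"
    unfolding assms(1) of_nat_eq_0_iff_char_dvd .
  then have "CHAR('a) dvd p" using pr p(2) prime_dvd_power by blast
  then have "CHAR('a) = p" using pr p(1) primes_dvd_imp_eq by blast
  then show ?thesis using freshmans_dream_sum'[OF pr] p(2) by blast
qed

text \<open>Raising a value to the power \<open>q\<close> sends the term at \<open>i\<close> to one
  at \<open>\<sigma> i\<close> with coefficient \<open>a i ^ q\<close>. All exponents stay below
  \<open>N\<close>, so coefficients can be compared.\<close>

lemma frobenius_fixed_iff:
  fixes a :: "nat \<Rightarrow> 'a::{field,finite}"
  assumes card: "CARD('a) = q ^ s" and "primepow q"
  shows "(\<forall>z\<in>Y_set N. (\<Sum>i<N. a i * z ^ i) ^ q = (\<Sum>i<N. a i * z ^ i))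
    \<longleftrightarrow> (\<forall>i<N. a (\<sigma> i) = a i ^ q)"
proof -
  \<comment> \<open>The inverse of \<open>\<sigma>\<close> on \<open>{..<N}\<close>, since
    \<open>\<sigma> ^^ s\<close> is the identity there.\<close>
  define \<tau> where "\<tau> = \<sigma> ^^ (s - 1)"
  have \<tau>\<sigma>: "\<tau> (\<sigma> i) = i" and \<sigma>\<tau>: "\<sigma> (\<tau> i) = i" and \<tau>N: "\<tau> i < N" if "i < N" for i
  proof -
    have "(\<sigma> ^^ (s - 1 + 1)) i = i" "(\<sigma> ^^ (1 + (s - 1))) i = i"
      using funpow_s[OF that] s_pos by simp_all
    then show "\<tau> (\<sigma> i) = i" "\<sigma> (\<tau> i) = i" "\<tau> i < N"
      using funpow_less[OF that] unfolding \<tau>_def funpow_add comp_apply by simp_all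
  qed
  have frob: "(\<Sum>i<N. a i * z ^ i) ^ q = (\<Sum>i<N. a (\<tau> i) ^ q * z ^ i)" if z: "z \<in> Y_set N" for z
  proof -
    have "(\<Sum>i<N. a i * z ^ i) ^ q = (\<Sum>i<N. a i ^ q * z ^ \<sigma> i)"
      using power_cyc_mult[OF z, of q] q_gt_1
      by (simp add: power_q_sum[OF assms] power_mult_distrib mult.commute flip: power_mult)
    also have "\<dots> = (\<Sum>i<N. a (\<tau> i) ^ q * z ^ i)"
      by (rule sum.reindex_bij_witness[of _ \<tau> \<sigma>]) (auto simp: \<tau>\<sigma> \<sigma>\<tau> \<tau>N)
    finally show ?thesis .
  qed
  have "(\<forall>z\<in>Y_set N. (\<Sum>i<N. a i * z ^ i) ^ q = (\<Sum>i<N. a i * z ^ i))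
    \<longleftrightarrow> (\<forall>i<N. a (\<tau> i) ^ q = a i)"
  proof
    assume "\<forall>z\<in>Y_set N. (\<Sum>i<N. a i * z ^ i) ^ q = (\<Sum>i<N. a i * z ^ i)"
    then show "\<forall>i<N. a (\<tau> i) ^ q = a i"
      using coeffs_eqI_Y_set[OF card, of "\<lambda>i. a (\<tau> i) ^ q" a] frob by simp
  next
    assume "\<forall>i<N. a (\<tau> i) ^ q = a i"
    then show "\<forall>z\<in>Y_set N. (\<Sum>i<N. a i * z ^ i) ^ q = (\<Sum>i<N. a i * z ^ i)"
      by (simp add: frob)
  qed
  also have "\<dots> \<longleftrightarrow> (\<forall>i<N. a (\<sigma> i) = a i ^ q)"
    using \<tau>\<sigma> \<sigma>\<tau> \<tau>N cyc_mult_less by metis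
  finally show ?thesis .
qed

text \<open>One inclusion holds because \<open>x ^ q = x\<close> in the small field; both sets have
  \<open>q\<close> elements as \<open>\<iota>\<close> is injective.\<close>

lemma range_field_embedding:
  fixes \<iota> :: "'k::{field,finite} \<Rightarrow> 'a::{field,finite}"
  assumes "field_embedding \<iota>" "CARD('k) = q" "CARD('a) = q ^ s"
  shows "range \<iota> = {x. x ^ q = x}"
proof (rule card_subset_eq)
  have mult: "\<iota> (x * y) = \<iota> x * \<iota> y" and add: "\<iota> (x + y) = \<iota> x + \<iota> y" and one: "\<iota> 1 = 1" for x y
    using assms(1) by (auto simp: field_embedding_def)
  have pow: "\<iota> (x ^ n) = \<iota> x ^ n" for x n by (induction n) (simp_all add: mult one)
  show "range \<iota> \<subseteq> {x. x ^ q = x}"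
    using power_CARD_eq_same[where 'a = 'k] assms(2) by (auto simp flip: pow)
  have zero: "\<iota> 0 = 0" using add[of 0 0] by (metis add_cancel_right_right)
  have "inj \<iota>"
  proof (rule injI)
    fix x y assume "\<iota> x = \<iota> y"
    then have "\<iota> (x - y) = 0" using add[of "x - y" y] by simp
    then have "x - y = 0"
      using mult[of "x - y" "inverse (x - y)"] one by (cases "x - y = 0") auto
    then show "x = y" by simp
  qed
  then show "card (range \<iota>) = card {x::'a. x ^ q = x}"
    using card_power_q_power_eq_same[OF assms(3), of 1] assms(2) by (simp add: card_image)
qed simp

end

section \<open>The subfield subcode as a subspace and its number of words\<close>

lemma bi_eval_bi_monom: "bi_eval (bi_monom i j) (x, y) = x ^ i * y ^ j"
  by (simp add: bi_eval_def bi_monom_def poly_monom)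

text \<open>The span is closed under all scalars of the large field, in particular under
  \<open>\<iota> c\<close>; values in \<open>range \<iota>\<close> are preserved because
  \<open>\<iota>\<close> respects sums and products.\<close>

lemma subspace_PRS_sub:
  assumes "field_embedding \<iota>"
  shows "module.subspace (word_scale \<iota>) (PRS_sub \<iota> N \<Delta>)"
proof -
  interpret L: vector_space "word_scale (\<lambda>x. x) :: 'b \<Rightarrow> ('b \<times> 'b \<Rightarrow> 'b) \<Rightarrow> _"
    by (rule vector_space_word_scale[OF field_embedding_id])
  interpret K: vector_space "word_scale \<iota> :: 'a \<Rightarrow> ('b \<times> 'b \<Rightarrow> 'b) \<Rightarrow> _"
    by (rule vector_space_word_scale[OF assms])
  have mult: "\<iota> (x * y) = \<iota> x * \<iota> y" and add: "\<iota> (x + y) = \<iota> x + \<iota> y" for x y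
    using assms by (auto simp: field_embedding_def)
  have zero: "\<iota> 0 = 0" using add[of 0 0] by (metis add_cancel_right_right)
  have sub: "L.subspace (PRS N \<Delta>)" unfolding PRS_def by (rule L.subspace_span)
  have "word_scale \<iota> c x \<in> PRS N \<Delta>" if "x \<in> PRS N \<Delta>" for c x
    using L.subspace_scale[OF sub that, of "\<iota> c"] by (simp add: word_scale_def)
  moreover have "word_scale \<iota> c x \<in> words N (range \<iota>)" if "x \<in> words N (range \<iota>)" for c x
    using that by (force simp: words_def word_scale_def simp flip: mult)
  moreover have "x + y \<in> words N (range \<iota>)"
    if x: "x \<in> words N (range \<iota>)" and y: "y \<in> words N (range \<iota>)" for x y
  proof -
    have "x P + y P \<in> range \<iota>" if "P \<in> X_set N" for P
    proof -
      have "x P \<in> range \<iota>" "y P \<in> range \<iota>" using x y that by (simp_all add: words_def)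
      then obtain u v where "x P = \<iota> u" "y P = \<iota> v" by (elim rangeE)
      then show ?thesis by (simp flip: add)
    qed
    then show ?thesis using x y by (simp add: words_def)
  qed
  moreover have "0 \<in> words N (range \<iota>)" using zero by (auto simp: words_def intro: range_eqI[of _ _ 0])
  ultimately show ?thesis
    using L.subspace_add[OF sub] L.subspace_0[OF sub]
    by (intro K.subspaceI) (auto simp: PRS_sub_def)
qed

context cyclotomic
begin

text \<open>Evaluation \<open>w\<close> maps \<open>coeffs_sub \<Delta> d\<close> bijectively onto
  the code. The points \<open>(1, z)\<close> alone give injectivity; together with
  \<open>(0, 1)\<close> they decide which words have values in the small field.\<close>

lemma card_PRS_sub:
  fixes \<iota> :: "'k::{field,finite} \<Rightarrow> 'a::{field,finite}"
  assumes pq: "primepow q" and cardk: "CARD('k) = q" and card: "CARD('a) = q ^ s"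
    and emb: "field_embedding \<iota>"
    and \<Delta>: "\<Delta> \<subseteq> {..<N}" "\<Delta> \<noteq> {}" "d = Max \<Delta>"
  shows "card (PRS_sub \<iota> N \<Delta>) = card (coeffs_sub \<Delta> d :: (nat \<Rightarrow> 'a) set)"
proof -
  interpret L: vector_space "word_scale (\<lambda>x. x) :: 'a \<Rightarrow> ('a \<times> 'a \<Rightarrow> 'a) \<Rightarrow> _"
    by (rule vector_space_word_scale[OF field_embedding_id])
  define w :: "(nat \<Rightarrow> 'a) \<Rightarrow> 'a \<times> 'a \<Rightarrow> 'a"
    where "w a = (\<Sum>i\<in>\<Delta>. word_scale (\<lambda>x. x) (a i) (ev N (bi_monom (d - i) i)))" for a
  have fin: "finite \<Delta>" using \<Delta>(1) finite_subset by blast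
  have le: "i \<le> d" if "i \<in> \<Delta>" for i using that fin \<Delta>(3) by simp
  have d: "d \<in> \<Delta>" using fin \<Delta> by simp
  have sum_apply: "(\<Sum>i\<in>A. f i) P = (\<Sum>i\<in>A. f i P)" for f :: "nat \<Rightarrow> 'a \<times> 'a \<Rightarrow> 'a" and A P
    by (induction A rule: infinite_finite_induct) simp_all
  have w_off: "w a P = 0" if "P \<notin> X_set N" for a P
    using that by (simp add: w_def sum_apply word_scale_def ev_def)
  have w_affine: "w a (1, z) = (\<Sum>i<N. a i * z ^ i)"
    if z: "z \<in> Y_set N" and a: "\<And>i. i \<notin> \<Delta> \<Longrightarrow> a i = 0" for a z
  proof -
    have "w a (1, z) = (\<Sum>i\<in>\<Delta>. a i * z ^ i)"
      using z by (simp add: w_def sum_apply word_scale_def ev_def X_set_def bi_eval_bi_monom)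
    also have "\<dots> = (\<Sum>i<N. a i * z ^ i)" using \<Delta>(1) a by (intro sum.mono_neutral_left) auto
    finally show ?thesis .
  qed
  \<comment> \<open>Every monomial except the one for \<open>i = d\<close> contains a positive power
    of the first variable; for \<open>i = d\<close> the factor is \<open>0 ^ 0 = 1\<close>.\<close>
  have w_inf: "w a (0, 1) = a d" for a
  proof -
    have "w a (0, 1) = (\<Sum>i\<in>\<Delta>. a i * 0 ^ (d - i))"
      by (simp add: w_def sum_apply word_scale_def ev_def X_set_def bi_eval_bi_monom)
    also have "\<dots> = (\<Sum>i\<in>\<Delta>. if i = d then a i else 0)"
      using le by (intro sum.cong) (auto simp: power_0_left dest: le_antisym)
    also have "\<dots> = a d" using fin d by simp
    finally show ?thesis .
  qed
  have words_iff: "w a \<in> words N (range \<iota>) \<longleftrightarrow> a \<in> coeffs_sub \<Delta> d"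
    if a: "\<And>i. i \<notin> \<Delta> \<Longrightarrow> a i = 0" for a
  proof -
    have "w a \<in> words N (range \<iota>) \<longleftrightarrow> (\<forall>P\<in>X_set N. w a P ^ q = w a P)"
      using w_off by (auto simp: words_def range_field_embedding[OF emb cardk card])
    also have "\<dots> \<longleftrightarrow> (\<forall>z\<in>Y_set N. w a (1, z) ^ q = w a (1, z)) \<and> w a (0, 1) ^ q = w a (0, 1)"
      by (auto simp: X_set_def)
    also have "\<dots> \<longleftrightarrow> a \<in> coeffs_sub \<Delta> d"
      using a by (simp add: w_affine w_inf frobenius_fixed_iff[OF card pq] coeffs_sub_def)
    finally show ?thesis .
  qed
  have "bij_betw w (coeffs_sub \<Delta> d) (PRS_sub \<iota> N \<Delta>)"
    unfolding bij_betw_def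
  proof
    show "inj_on w (coeffs_sub \<Delta> d)"
    proof (intro inj_onI ext)
      fix a a' i assume a: "a \<in> coeffs_sub \<Delta> d" "a' \<in> coeffs_sub \<Delta> d" and eq: "w a = w a'"
      have supp: "a j = 0" "a' j = 0" if "j \<notin> \<Delta>" for j
        using a that by (auto simp: coeffs_sub_def)
      show "a i = a' i"
      proof (cases "i \<in> \<Delta>")
        case True
        then have "i < N" using \<Delta>(1) by auto
        then show ?thesis
          using coeffs_eqI_Y_set[OF card, of a a' i] w_affine[of _ a] w_affine[of _ a'] supp eq by simp
      qed (simp add: supp)
    qed
    have PRS: "PRS N \<Delta> = range w"
      unfolding PRS_def L.span_image_finite[OF fin] w_def \<Delta>(3) ..
    show "w ` coeffs_sub \<Delta> d = PRS_sub \<iota> N \<Delta>"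
    proof
      show "w ` coeffs_sub \<Delta> d \<subseteq> PRS_sub \<iota> N \<Delta>"
        using words_iff by (auto simp: PRS_sub_def PRS coeffs_sub_def)
      show "PRS_sub \<iota> N \<Delta> \<subseteq> w ` coeffs_sub \<Delta> d"
      proof
        fix v assume v: "v \<in> PRS_sub \<iota> N \<Delta>"
        then obtain u where u: "v = w u" by (auto simp: PRS_sub_def PRS)
        \<comment> \<open>The values of \<open>u\<close> outside \<open>\<Delta>\<close> do not
          affect \<open>w u\<close>; setting them to zero gives the support condition of
          \<open>coeffs_sub\<close>.\<close>
        define a where "a i = (if i \<in> \<Delta> then u i else 0)" for i
        have "v = w a" unfolding u w_def by (intro sum.cong) (simp_all add: a_def)
        moreover have "a \<in> coeffs_sub \<Delta> d"
          using v words_iff[of a] \<open>v = w a\<close> by (simp add: PRS_sub_def a_def)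
        ultimately show "v \<in> w ` coeffs_sub \<Delta> d" by blast
      qed
    qed
  qed
  then show ?thesis by (simp add: bij_betw_same_card)
qed

end

section \<open>From the number of words to the dimension formula\<close>

theorem corollary3p7:
  fixes q s N d :: nat
    and \<iota> :: "'k::{field,finite} \<Rightarrow> 'a::{field,finite}"
    and \<Delta> :: "nat set"
  assumes "primepow q" and "s \<ge> 1"
    and "CARD('k) = q" and "CARD('a) = q ^ s" and "field_embedding \<iota>"
    and "N > 1" and "(N - 1) dvd (q ^ s - 1)"
    and "\<Delta> \<noteq> {}" and "\<Delta> \<subseteq> {0..N - 1}" and "0 \<in> \<Delta>" and "d = Max \<Delta>"
  shows "(cyc_set q N d \<subseteq> \<Delta> \<longrightarrow>
            int (dim_sub \<iota> (PRS_sub \<iota> N \<Delta>))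
              = (\<Sum>b\<in>{b \<in> cyc_reps q N. cyc_set q N b \<subseteq> \<Delta>}. int (card (cyc_set q N b)))
                  - (int (card (cyc_set q N d)) - 1) \<and>
            (\<Sum>b\<in>{b \<in> cyc_reps q N. cyc_set q N b \<subseteq> \<Delta>}. int (card (cyc_set q N b)))
                  - (int (card (cyc_set q N d)) - 1)
              = (\<Sum>b\<in>{b \<in> cyc_reps q N. cyc_set q N b \<subseteq> \<Delta> \<and> b < d}. int (card (cyc_set q N b))) + 1) \<and>
         (\<not> cyc_set q N d \<subseteq> \<Delta> \<longrightarrow>
            int (dim_sub \<iota> (PRS_sub \<iota> N \<Delta>))
              = (\<Sum>b\<in>{b \<in> cyc_reps q N. cyc_set q N b \<subseteq> \<Delta>}. int (card (cyc_set q N b))))"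
proof -
  interpret cyclotomic q s N
    using assms(1,2,6,7) primepow_gt_Suc_0[of q] by unfold_locales auto
  interpret K: vector_space "word_scale \<iota> :: 'k \<Rightarrow> ('a \<times> 'a \<Rightarrow> 'a) \<Rightarrow> _"
    by (rule vector_space_word_scale[OF assms(5)])
  have \<Delta>: "\<Delta> \<subseteq> {..<N}" using assms(6,9) by auto
  have fin: "finite \<Delta>" using \<Delta> finite_subset by blast
  have d: "d \<in> \<Delta>" "d < N" using fin \<Delta> assms(8,11) Max_in by auto
  define R where "R = {b \<in> cyc_reps q N. orb b \<subseteq> \<Delta>}"
  have finR: "finite R"
    by (rule finite_subset[of _ "{..<N}"]) (auto simp: R_def cyc_reps_iff)
  \<comment> \<open>As the maximum of \<open>\<Delta>\<close>, \<open>d\<close> is also the maximum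
    of its own orbit once that orbit lies in \<open>\<Delta>\<close>.\<close>
  have rep: "d \<in> cyc_reps q N" if "orb d \<subseteq> \<Delta>"
  proof -
    have "Max (orb d) = d"
      using that fin finite_orb self_in_orb[OF d(2)] assms(11) by (intro Max_eqI) auto
    then show ?thesis using d(2) by (simp add: cyc_reps_iff)
  qed
  have "q ^ dim_sub \<iota> (PRS_sub \<iota> N \<Delta>) = card (PRS_sub \<iota> N \<Delta>)"
    using K.card_subspace[OF subspace_PRS_sub[OF assms(5)]] assms(3) by (simp add: dim_sub_def)
  also have "\<dots> = q ^ (\<Sum>b\<in>R. if b = d then 1 else card (orb b))"
    unfolding R_def
    using card_PRS_sub[OF assms(1,3,4,5) \<Delta> assms(8,11)] card_coeffs_sub[OF assms(4) \<Delta> d(2) rep]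
    by simp
  \<comment> \<open>Two equal powers of \<open>q > 1\<close> have equal exponents.\<close>
  finally have dim: "dim_sub \<iota> (PRS_sub \<iota> N \<Delta>) = (\<Sum>b\<in>R. if b = d then 1 else card (orb b))"
    using q_gt_1 by (simp add: power_inject_exp)
  show ?thesis
  proof (intro conjI impI)
    assume od: "orb d \<subseteq> \<Delta>"
    then have dR: "d \<in> R" using rep by (simp add: R_def)
    \<comment> \<open>A representative lies in its own orbit, hence in \<open>\<Delta>\<close>, and
      so is at most \<open>d\<close>; \<open>b < d\<close> excludes only \<open>d\<close>.\<close>
    have below: "{b \<in> cyc_reps q N. orb b \<subseteq> \<Delta> \<and> b < d} = R - {d}"
    proof -
      have "b \<le> d" if "b \<in> R" for b
        using that self_in_orb[of b] fin assms(11) by (auto simp: R_def cyc_reps_iff)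
      then show ?thesis by (force simp: R_def)
    qed
    have total: "(\<Sum>b\<in>R. int (card (orb b))) = int (card (orb d)) + (\<Sum>b\<in>R - {d}. int (card (orb b)))"
      using finR dR by (rule sum.remove)
    then show "(\<Sum>b\<in>{b \<in> cyc_reps q N. orb b \<subseteq> \<Delta>}. int (card (orb b))) - (int (card (orb d)) - 1)
        = (\<Sum>b\<in>{b \<in> cyc_reps q N. orb b \<subseteq> \<Delta> \<and> b < d}. int (card (orb b))) + 1"
      unfolding below by (simp flip: R_def)
    have "int (dim_sub \<iota> (PRS_sub \<iota> N \<Delta>)) = 1 + (\<Sum>b\<in>R - {d}. int (card (orb b)))"
      unfolding dim sum.remove[OF finR dR] by simp
    then show "int (dim_sub \<iota> (PRS_sub \<iota> N \<Delta>))
        = (\<Sum>b\<in>{b \<in> cyc_reps q N. orb b \<subseteq> \<Delta>}. int (card (orb b))) - (int (card (orb d)) - 1)"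
      using total by (simp flip: R_def)
  next
    assume "\<not> orb d \<subseteq> \<Delta>"
    \<comment> \<open>No summand is then the exceptional \<open>1\<close>, and every orbit counts in
      full.\<close>
    then have "b \<noteq> d" if "b \<in> R" for b using that by (auto simp: R_def)
    then show "int (dim_sub \<iota> (PRS_sub \<iota> N \<Delta>))
        = (\<Sum>b\<in>{b \<in> cyc_reps q N. orb b \<subseteq> \<Delta>}. int (card (orb b)))"
      unfolding dim by (simp flip: R_def)
  qed
qed

end
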